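(* Let $a<b$ be real, $s\in\mathbb{C}$, and let $\Psi\in C^1([a,b])$ be a positive increasing function with $\Psi'(x)\neq0$ for all $x\in[a,b]$. The Hadamard-type (or tempered) fractional operators with respect to $\Psi$ have the following semigroup properties: $${}^{H}_{a}I^{\nu,s}_{\Psi(x)}\,{}^{H}_{a}I^{\mu,s}_{\Psi(x)}f(x)={}^{H}_{a}I^{\nu+\mu,s}_{\Psi(x)}f(x),\qquad \mu,\nu>0;$$ $${}^{HR}_{a}D^{\mu,s}_{\Psi(x)}\,{}^{H}_{a}I^{\nu,s}_{\Psi(x)}f(x)={}^{HR}_{a}D^{\mu-\nu,s}_{\Psi(x)}f(x),\qquad \nu>0,\ \mu\in\mathbb{R};$$ $$\Psi(x)^{-s}\left(\frac{\Psi(x)}{\Psi'(x)}\cdot\frac{d}{dx}\right)^n\Psi(x)^s\,{}^{HR}_{a}D^{\mu,s}_{\Psi(x)}f(x)={}^{HR}_{a}D^{n+\mu,s}_{\Psi(x)}f(x),\qquad n\in\mathbb{Z}^{+},\ \mu\in\mathbb{R},$$ where in the last two identities the operators denoted by $D$ may be either fractional derivatives or fractional integrals according to the sign of the index.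
   Context: Identities are understood for integrable functions $f$ on $[a,b]$ for which the expressions are defined. Hadamard-type operators with respect to $\Psi$ (equivalently, tempered operators with respect to $\log\circ\Psi$): for $\mu>0$, $${}^{H}_{a}I^{\mu,s}_{\Psi(x)}f(x)=\frac{1}{\Gamma(\mu)}\int_{a}^{x}\left(\frac{\Psi(t)}{\Psi(x)}\right)^{s}\left(\log\frac{\Psi(x)}{\Psi(t)}\right)^{\mu-1}f(t)\frac{\Psi'(t)}{\Psi(t)}\,dt,\quad x\in[a,b];$$ for a nonnegative integer $n$, $${}^{H}_{a}D^{n,s}_{\Psi(x)}f(x)=\Psi(x)^{-s}\left(\frac{\Psi(x)}{\Psi'(x)}\frac{d}{dx}\right)^{n}\big[\Psi(x)^{s}f(x)\big];$$ and for $\mu\ge0$ with $n=\lfloor\mu\rfloor+1$, ${}^{HR}_{a}D^{\mu,s}_{\Psi(x)}f={}^{H}_{a}D^{n,s}_{\Psi(x)}\,{}^{H}_{a}I^{n-\mu,s}_{\Psi(x)}f$. For negative index the convention is ${}^{HR}_{a}D^{-\mu,s}_{\Psi(x)}={}^{H}_{a}I^{\mu,s}_{\Psi(x)}$ for $\mu>0$.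
   Formalization: The second and third identities are stated for x in (a,b] only; at x=a they can fail, e.g. Ψ=exp, s=0, f(t)=(t−a)^{−c} with 0<c<1, where D^0 I^c f(a)=Γ(1−c) but I^c f(a)=0. *)

theory Defs
  imports "HOL-Analysis.Analysis"
begin

text \<open>
  A function given by a singular integral or by derivatives need not be defined at every point,
  so all operators act on partial functions \<open>real \<rightharpoonup> complex\<close>, and the domain of the result records
  where the expression makes sense. In this way the domain of a composite expression
  takes care of itself. \<open>\<Psi>'\<close> stands for the derivative of \<open>\<Psi>\<close> on \<open>{a..b}\<close>.
\<close>

definition hadamard_integrand ::
  "(real \<Rightarrow> real) \<Rightarrow> (real \<Rightarrow> real) \<Rightarrow> real \<Rightarrow> complex \<Rightarrow> (real \<rightharpoonup> complex) \<Rightarrow> real \<Rightarrow> real \<Rightarrow> complex"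
  where
  "hadamard_integrand \<Psi> \<Psi>' \<mu> s f x t =
     complex_of_real (\<Psi> t / \<Psi> x) powr s * of_real (ln (\<Psi> x / \<Psi> t) powr (\<mu> - 1))
       * the (f t) * of_real (\<Psi>' t / \<Psi> t)"

text \<open>
  The integral is a Lebesgue integral: it is defined at \<open>x\<close> iff \<open>f\<close> is defined almost everywhere
  on \<open>{a..x}\<close> and the integrand is absolutely integrable there. It is meant for \<open>\<mu> > 0\<close>.
  At \<open>x = a\<close> the value is \<open>0\<close>, even when the integral has a nonzero limit as \<open>x\<close> tends to \<open>a\<close>; hence an
  identity of the form derivative of integral equals integral may fail at this one point.
\<close>

definition hadamard_integral ::
  "real \<Rightarrow> real \<Rightarrow> (real \<Rightarrow> real) \<Rightarrow> (real \<Rightarrow> real) \<Rightarrow> real \<Rightarrow> complex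
     \<Rightarrow> (real \<rightharpoonup> complex) \<Rightarrow> (real \<rightharpoonup> complex)"
  where
  "hadamard_integral a b \<Psi> \<Psi>' \<mu> s f x =
     (if x \<in> {a..b} \<and> negligible ({a..x} - dom f)
         \<and> hadamard_integrand \<Psi> \<Psi>' \<mu> s f x absolutely_integrable_on {a..x}
      then Some (of_real (1 / Gamma \<mu>) * (LINT t:{a..x}|lebesgue. hadamard_integrand \<Psi> \<Psi>' \<mu> s f x t))
      else None)"

text \<open>
  The derivative at \<open>x\<close> requires the function to be defined on a neighbourhood of \<open>x\<close> in \<open>{a..b}\<close>;
  it is one-sided at the end points.
\<close>

definition partial_deriv :: "real \<Rightarrow> real \<Rightarrow> (real \<rightharpoonup> complex) \<Rightarrow> (real \<rightharpoonup> complex)" where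
  "partial_deriv a b g x =
     (if x \<in> {a..b} \<and> x \<in> dom g \<and> (\<forall>\<^sub>F t in at x within {a..b}. t \<in> dom g)
         \<and> (\<lambda>t. the (g t)) differentiable (at x within {a..b})
      then Some (vector_derivative (\<lambda>t. the (g t)) (at x within {a..b}))
      else None)"

definition partial_mult :: "(real \<Rightarrow> complex) \<Rightarrow> (real \<rightharpoonup> complex) \<Rightarrow> (real \<rightharpoonup> complex)" where
  "partial_mult c g x = map_option (\<lambda>y. c x * y) (g x)"

definition hadamard_deriv ::
  "real \<Rightarrow> real \<Rightarrow> (real \<Rightarrow> real) \<Rightarrow> (real \<Rightarrow> real) \<Rightarrow> nat \<Rightarrow> complex
     \<Rightarrow> (real \<rightharpoonup> complex) \<Rightarrow> (real \<rightharpoonup> complex)"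
  where
  "hadamard_deriv a b \<Psi> \<Psi>' n s f =
     partial_mult (\<lambda>x. of_real (\<Psi> x) powr (- s))
       (((\<lambda>g. partial_mult (\<lambda>x. of_real (\<Psi> x / \<Psi>' x)) (partial_deriv a b g)) ^^ n)
         (partial_mult (\<lambda>x. of_real (\<Psi> x) powr s) f))"

text \<open>
  The Riemann--Liouville style operator of arbitrary real order. Order \<open>0\<close> falls under the
  derivative clause, with \<open>n = 1\<close>.
\<close>

definition hadamard_RL ::
  "real \<Rightarrow> real \<Rightarrow> (real \<Rightarrow> real) \<Rightarrow> (real \<Rightarrow> real) \<Rightarrow> real \<Rightarrow> complex
     \<Rightarrow> (real \<rightharpoonup> complex) \<Rightarrow> (real \<rightharpoonup> complex)"
  where
  "hadamard_RL a b \<Psi> \<Psi>' \<mu> s f =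
     (if \<mu> < 0 then hadamard_integral a b \<Psi> \<Psi>' (- \<mu>) s f
      else (let n = nat \<lfloor>\<mu>\<rfloor> + 1 in
        hadamard_deriv a b \<Psi> \<Psi>' n s (hadamard_integral a b \<Psi> \<Psi>' (real n - \<mu>) s f)))"

end

theory Submission
  imports Defs "HOL-Real_Asymp.Real_Asymp"
begin

text \<open>
  Multiplication by \<open>\<Psi>\<^sup>s\<close> conjugates every operator of index \<open>s\<close> into the one of index \<open>0\<close>, and with
  \<open>\<phi> = ln \<circ> \<Psi>\<close> the latter are the classical Riemann--Liouville operators with respect to the increasing
  function \<open>\<phi>\<close>: the integral \<open>J\<^sup>\<mu>\<close> with kernel \<open>(\<phi> x - \<phi> t)\<^bsup>\<mu>-1\<^esup> \<phi>' t / \<Gamma>(\<mu>)\<close> and the derivation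
  \<open>E = (1/\<phi>') d/dx\<close>. So it suffices to treat \<open>J\<close> and \<open>E\<close> on an integrable \<open>h = \<Psi>\<^sup>s f\<close>.

  The semigroup law \<open>J\<^sup>\<nu> J\<^sup>\<mu> h = J\<^bsup>\<nu>+\<mu>\<^esup> h\<close> is Fubini's theorem together with Euler's Beta integral. Absolute
  convergence of \<open>J\<^bsup>\<nu>+\<mu>\<^esup> h\<close> at the point \<open>x\<close> is exactly what Fubini needs, so the law holds
  at every point where the right-hand side is defined, not merely almost everywhere
  (\<open>RL_integral_semigroup\<close>).

  The remaining identities rest on \<open>E J\<^bsup>1+\<kappa>\<^esup> h = J\<^sup>\<kappa> h\<close>. For \<open>\<kappa> < 1\<close> the fundamental theorem of calculus gives
  this only almost everywhere, whereas here it is needed at each point \<open>x > a\<close> where both sides are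
  defined. If \<open>J\<^sup>\<kappa> h\<close> converges absolutely at \<open>x\<close>, then its integrand times a constant
  dominates all difference quotients of \<open>J\<^bsup>1+\<kappa>\<^esup> h\<close> taken from the left, because
  \<open>u\<^sup>\<kappa> - v\<^sup>\<kappa> \<le> max 1 \<kappa> (u - v) u\<^bsup>\<kappa>-1\<^esup>\<close>. So the left derivative exists and has the right value,
  and a two-sided derivative, if there is one, agrees with it (\<open>scale_deriv_RL_integral\<close>).

  By iteration \<open>E\<^sup>n J\<^bsup>n-\<rho>\<^esup> h\<close> does not depend on \<open>n > \<rho>\<close>, at points \<open>x > a\<close> where it exists for both choices
  (\<open>RL_op_eq\<close>). Both composition rules for derivatives follow, since differentiation
  is local and since a derivative that exists at \<open>x\<close> forces the function to be defined near \<open>x\<close>.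
\<close>

section \<open>Powers, Lebesgue measure and derivatives\<close>

lemma sigma_finite_lebesgue: "sigma_finite_measure (lebesgue :: 'a::euclidean_space measure)"
proof
  obtain A :: "'a set set" where A: "countable A" "A \<subseteq> sets lborel" "\<Union> A = space lborel"
      "\<forall>a\<in>A. emeasure lborel a \<noteq> \<infinity>"
    using lborel.sigma_finite_countable by auto
  then show "\<exists>A::'a set set. countable A \<and> A \<subseteq> sets lebesgue \<and> \<Union> A = space lebesgue \<and>
      (\<forall>a\<in>A. emeasure lebesgue a \<noteq> \<infinity>)"
    by (intro exI[of _ A]) (auto simp: subset_eq emeasure_completion)
qed

text \<open>
  For \<open>k \<le> 1\<close> the factor \<open>u powr (k - 1)\<close> is the smaller of the values of the decreasing function
  \<open>z powr (k - 1)\<close> at \<open>v\<close> and \<open>u\<close>, so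
  \<open>v * u powr (k - 1) \<le> v powr k\<close>; for \<open>k > 1\<close> it bounds the derivative in the mean value theorem.
  Keeping \<open>u\<close>, and not \<open>v\<close>, in the last factor is what makes the bound integrable later on.
\<close>

lemma powr_diff_le:
  fixes u v k :: real
  assumes "0 \<le> v" "v \<le> u" "0 < u" "0 < k"
  shows "u powr k - v powr k \<le> max 1 k * (u - v) * u powr (k - 1)"
proof (cases "k \<le> 1")
  case True
  have "v * u powr (k - 1) \<le> v powr k"
  proof (cases "v = 0")
    case False
    then have "v * u powr (k - 1) \<le> v * v powr (k - 1)"
      using assms True by (intro mult_left_mono powr_mono2') auto
    also have "\<dots> = v powr k"
      using assms False by (simp add: powr_mult_base)
    finally show ?thesis .
  qed simp
  moreover have "u powr k = u * u powr (k - 1)"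
    using assms by (simp add: powr_mult_base)
  ultimately show ?thesis
    using True assms by (auto simp add: algebra_simps max_def)
next
  case False
  consider "v = u" | "v = 0" "u \<noteq> 0" | "0 < v" "v < u" using assms by linarith
  then show ?thesis
  proof cases
    case 2
    then have "u powr k = 1 * (u * u powr (k - 1))"
      using assms by (simp add: powr_mult_base)
    also have "\<dots> \<le> max 1 k * (u * u powr (k - 1))"
      using assms by (intro mult_right_mono) auto
    finally show ?thesis using 2 assms by (simp add: mult.assoc)
  next
    case 3
    have "\<exists>z>v. z < u \<and> u powr k - v powr k = (u - v) * (k * z powr (k - 1))"
      using 3 by (intro MVT2 has_real_derivative_powr) auto
    then obtain z where z: "v < z" "z < u" "u powr k - v powr k = (u - v) * (k * z powr (k - 1))"
      by blast
    have "(u - v) * (k * z powr (k - 1)) \<le> (u - v) * (k * u powr (k - 1))"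
      using z assms False by (intro mult_left_mono powr_mono2) auto
    with z False show ?thesis by (simp add: algebra_simps max_def)
  qed simp
qed

lemma has_vector_derivative_tendsto_quotient:
  assumes "(f has_vector_derivative D) (at x within S)"
  shows "((\<lambda>t. (f t - f x) /\<^sub>R (t - x)) \<longlongrightarrow> D) (at x within S)"
proof -
  have "((\<lambda>t. norm ((f t - f x) - (t - x) *\<^sub>R D) / norm (t - x)) \<longlongrightarrow> 0) (at x within S)"
    using assms by (simp add: has_vector_derivative_def has_derivative_iff_norm)
  moreover have "norm ((f t - f x) - (t - x) *\<^sub>R D) / norm (t - x) = norm ((f t - f x) /\<^sub>R (t - x) - D)"
    if "t \<noteq> x" for t
  proof -
    have "(f t - f x) /\<^sub>R (t - x) - D = ((f t - f x) - (t - x) *\<^sub>R D) /\<^sub>R (t - x)"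
      using that by (simp add: scaleR_diff_right)
    then show ?thesis by (simp add: divide_inverse mult.commute)
  qed
  ultimately have "((\<lambda>t. norm ((f t - f x) /\<^sub>R (t - x) - D)) \<longlongrightarrow> 0) (at x within S)"
    by (elim Lim_transform_eventually) (auto simp: eventually_at_filter)
  then show ?thesis
    by (simp add: tendsto_norm_zero_iff LIM_zero_iff)
qed

lemma partial_deriv_cong:
  assumes "open U" "x \<in> U" "\<And>t. t \<in> U \<inter> {a..b} \<Longrightarrow> g1 t = g2 t"
  shows "partial_deriv a b g1 x = partial_deriv a b g2 x"
proof (cases "x \<in> {a..b}")
  case True
  have ev: "\<forall>\<^sub>F t in at x within {a..b}. g1 t = g2 t"
    using assms by (auto simp: eventually_at_topological)
  have same: "g1 x = g2 x" using assms True by auto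
  have "(\<forall>\<^sub>F t in at x within {a..b}. t \<in> dom g1) \<longleftrightarrow> (\<forall>\<^sub>F t in at x within {a..b}. t \<in> dom g2)"
    by (rule eventually_cong[OF ev]) (auto simp: dom_def)
  moreover have hd: "((\<lambda>t. the (g1 t)) has_vector_derivative D) (at x within {a..b}) \<longleftrightarrow>
      ((\<lambda>t. the (g2 t)) has_vector_derivative D) (at x within {a..b})" for D
  proof (rule has_vector_derivative_cong_ev)
    show "\<forall>\<^sub>F t in nhds x. t \<in> {a..b} \<longrightarrow> the (g1 t) = the (g2 t)"
      using assms by (auto simp: eventually_nhds)
  qed (simp add: same)
  moreover have "(\<lambda>t. the (g1 t)) differentiable (at x within {a..b}) \<longleftrightarrow>
      (\<lambda>t. the (g2 t)) differentiable (at x within {a..b})"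
    using hd by (metis differentiableI_vector vector_derivative_works)
  moreover have "vector_derivative (\<lambda>t. the (g1 t)) (at x within {a..b}) =
      vector_derivative (\<lambda>t. the (g2 t)) (at x within {a..b})"
    by (simp add: vector_derivative_def hd)
  ultimately show ?thesis
    using same by (simp add: partial_deriv_def dom_def)
next
  case False
  then have "partial_deriv a b g x = None" for g by (auto simp: partial_deriv_def)
  then show ?thesis by simp
qed

lemma partial_deriv_dom_nhd:
  assumes "x \<in> dom (partial_deriv a b g)"
  obtains U where "open U" "x \<in> U" "U \<inter> {a..b} \<subseteq> dom g"
proof -
  have "x \<in> dom g" "\<forall>\<^sub>F t in at x within {a..b}. t \<in> dom g"
    using assms by (auto simp: partial_deriv_def dom_def split: if_splits)
  then obtain U where "open U" "x \<in> U" "\<forall>t\<in>U. t \<noteq> x \<longrightarrow> t \<in> {a..b} \<longrightarrow> t \<in> dom g"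
    by (auto simp: eventually_at_topological)
  moreover from this have "t \<in> dom g" if "t \<in> U \<inter> {a..b}" for t
    using that \<open>x \<in> dom g\<close> by (cases "t = x") simp_all
  ultimately show ?thesis
    using that[of U] by blast
qed

lemma dom_partial_mult [simp]: "dom (partial_mult c g) = dom g"
  by (auto simp: partial_mult_def dom_def)

section \<open>Fractional calculus with respect to an increasing function\<close>

locale increasing_scale =
  fixes a b :: real and \<phi> w :: "real \<Rightarrow> real"
  assumes ab: "a < b"
    and deriv_scale: "\<And>x. x \<in> {a..b} \<Longrightarrow> (\<phi> has_real_derivative w x) (at x within {a..b})"
    and cont_w: "continuous_on {a..b} w"
    and w_pos: "\<And>x. x \<in> {a..b} \<Longrightarrow> w x > 0"
begin

definition kernel :: "real \<Rightarrow> real \<Rightarrow> real \<Rightarrow> real" where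
  "kernel \<mu> x t = (\<phi> x - \<phi> t) powr (\<mu> - 1) * w t"

definition RL_integral :: "real \<Rightarrow> (real \<rightharpoonup> complex) \<Rightarrow> (real \<rightharpoonup> complex)" where
  "RL_integral \<mu> g x =
     (if x \<in> {a..b} \<and> negligible ({a..x} - dom g)
         \<and> (\<lambda>t. of_real (kernel \<mu> x t) * the (g t)) absolutely_integrable_on {a..x}
      then Some (of_real (1 / Gamma \<mu>) * integral {a..x} (\<lambda>t. of_real (kernel \<mu> x t) * the (g t)))
      else None)"

definition scale_deriv :: "(real \<rightharpoonup> complex) \<Rightarrow> (real \<rightharpoonup> complex)" where
  "scale_deriv g = partial_mult (\<lambda>x. of_real (1 / w x)) (partial_deriv a b g)"

definition RL_op :: "real \<Rightarrow> (real \<rightharpoonup> complex) \<Rightarrow> (real \<rightharpoonup> complex)" where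
  "RL_op \<mu> g =
     (if \<mu> < 0 then RL_integral (- \<mu>) g
      else (let n = nat \<lfloor>\<mu>\<rfloor> + 1 in (scale_deriv ^^ n) (RL_integral (real n - \<mu>) g)))"

lemma cont_scale: "continuous_on {a..b} \<phi>"
  by (meson deriv_scale DERIV_continuous continuous_on_eq_continuous_within)

lemma scale_less:
  assumes xy: "x < y" "x \<in> {a..b}" "y \<in> {a..b}"
  shows "\<phi> x < \<phi> y"
proof (rule DERIV_pos_imp_increasing_open[of x y \<phi>])
  show "continuous_on {x..y} \<phi>"
    by (rule continuous_on_subset[OF cont_scale]) (use xy in auto)
  fix z assume z: "x < z" "z < y"
  then have "(\<phi> has_real_derivative w z) (at z within {a..b})" "z \<in> interior {a..b}"
    using xy deriv_scale by auto
  then show "\<exists>l. (\<phi> has_real_derivative l) (at z) \<and> 0 < l"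
    by (metis at_within_interior interior_subset subsetD w_pos)
qed (use xy in auto)

lemma scale_le: "x \<le> y \<Longrightarrow> x \<in> {a..b} \<Longrightarrow> y \<in> {a..b} \<Longrightarrow> \<phi> x \<le> \<phi> y"
  using scale_less[of x y] by (cases "x = y") auto

lemma kernel_nonneg: "t \<in> {a..b} \<Longrightarrow> 0 \<le> kernel \<mu> x t"
  by (auto simp: kernel_def intro!: mult_nonneg_nonneg less_imp_le[OF w_pos])

lemma kernel_self [simp]: "kernel \<mu> x x = 0"
  by (simp add: kernel_def)

lemma kernel_pos: "t < x \<Longrightarrow> t \<in> {a..b} \<Longrightarrow> x \<in> {a..b} \<Longrightarrow> 0 < kernel \<mu> x t"
  using scale_less[of t x] w_pos by (simp add: kernel_def)

text \<open>
  The substitution \<open>u = (\<phi> t - \<phi> \<tau>) / (\<phi> x - \<phi> \<tau>)\<close> maps \<open>{\<tau>..x}\<close> onto the unit interval and turns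
  the product of the two kernels into Euler's Beta integrand.
\<close>

lemma has_integral_kernel_mult_kernel:
  assumes "\<mu> > 0" "\<nu> > 0" "\<tau> \<in> {a..b}" "x \<in> {\<tau>..b}"
  shows "((\<lambda>t. kernel \<nu> x t * kernel \<mu> t \<tau>) has_integral Beta \<mu> \<nu> * kernel (\<nu> + \<mu>) x \<tau>) {\<tau>..x}"
proof (cases "\<tau> = x")
  case True
  then show ?thesis by (simp add: has_integral_refl)
next
  case False
  define L where "L = \<phi> x - \<phi> \<tau>"
  define g where "g = (\<lambda>t. (\<phi> t - \<phi> \<tau>) / L)"
  define f where "f = (\<lambda>u::real. u powr (\<mu> - 1) * (1 - u) powr (\<nu> - 1))"
  have L: "L > 0" using scale_less[of \<tau> x] assms False by (simp add: L_def)
  have sub: "{\<tau>..x} \<subseteq> {a..b}" using assms by auto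
  have g_deriv: "(g has_field_derivative w t / L) (at t within {\<tau>..x})" if "t \<in> {\<tau>..x}" for t
    unfolding g_def using that sub L
    by (auto intro!: derivative_eq_intros DERIV_subset[OF deriv_scale])
  have g_less: "g s < g t" if "s < t" "s \<in> {\<tau>..x}" "t \<in> {\<tau>..x}" for s t
    using scale_less[of s t] that sub L by (auto simp: g_def intro!: divide_strict_right_mono)
  have inj: "inj_on g {\<tau>..x}"
    by (rule linorder_inj_onI) (use g_less in force)+
  have g_cont: "continuous_on {\<tau>..x} g"
    by (meson g_deriv DERIV_continuous continuous_on_eq_continuous_within)
  have g_ends: "g \<tau> = 0" "g x = 1" using L by (auto simp: g_def L_def)
  have img: "g ` {\<tau>..x} = {0..1}"
  proof
    have "g t \<in> {0..1}" if "t \<in> {\<tau>..x}" for t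
      using that g_less[of \<tau> t] g_less[of t x] g_ends by (cases "t = \<tau>"; cases "t = x") auto
    then show "g ` {\<tau>..x} \<subseteq> {0..1}" by blast
    show "{0..1} \<subseteq> g ` {\<tau>..x}"
      using IVT'[of g \<tau> _ x] g_ends g_cont assms by fastforce
  qed
  have "(f has_integral Beta \<mu> \<nu>) {0..1}"
    unfolding f_def by (rule has_integral_Beta_real) fact+
  then have "f absolutely_integrable_on g ` {\<tau>..x} \<and> integral (g ` {\<tau>..x}) f = Beta \<mu> \<nu>"
    unfolding img by (auto intro!: nonnegative_absolutely_integrable_1 simp: f_def integral_unique)
  then have "(\<lambda>t. \<bar>w t / L\<bar> * f (g t)) absolutely_integrable_on {\<tau>..x} \<and>
      integral {\<tau>..x} (\<lambda>t. \<bar>w t / L\<bar> * f (g t)) = Beta \<mu> \<nu>"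
    by (subst has_absolute_integral_change_of_variables_1'[OF _ g_deriv inj]) auto
  then have "((\<lambda>t. \<bar>w t / L\<bar> * f (g t)) has_integral Beta \<mu> \<nu>) {\<tau>..x}"
    using set_lebesgue_integral_eq_integral(1) has_integral_iff by blast
  then have "((\<lambda>t. kernel (\<nu> + \<mu>) x \<tau> * (\<bar>w t / L\<bar> * f (g t))) has_integral
      kernel (\<nu> + \<mu>) x \<tau> * Beta \<mu> \<nu>) {\<tau>..x}"
    by (rule has_integral_mult_right)
  moreover have "kernel (\<nu> + \<mu>) x \<tau> * (\<bar>w t / L\<bar> * f (g t)) = kernel \<nu> x t * kernel \<mu> t \<tau>"
    if t: "t \<in> {\<tau>..x}" for t
  proof -
    have "1 - g t = (\<phi> x - \<phi> t) / L"
      using L by (simp add: g_def L_def field_simps)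
    moreover have "\<phi> \<tau> \<le> \<phi> t" "\<phi> t \<le> \<phi> x" "w t > 0"
      using t sub by (auto intro!: scale_le w_pos)
    moreover have "L powr (\<nu> + \<mu> - 1) = L powr (\<mu> - 1) * L powr (\<nu> - 1) * L"
      using L by (simp add: powr_add[symmetric] powr_mult_base mult.commute add.commute)
    ultimately show ?thesis
      using L unfolding kernel_def f_def
      by (simp add: L_def[symmetric] g_def powr_divide)
  qed
  ultimately show ?thesis
    by (subst has_integral_cong[where g="\<lambda>t. kernel (\<nu> + \<mu>) x \<tau> * (\<bar>w t / L\<bar> * f (g t))"])
       (simp_all add: mult.commute)
qed

section \<open>The semigroup law\<close>

lemma clipped_measurable:
  assumes "continuous_on {a..b} (g :: real \<Rightarrow> real)"
  shows "(\<lambda>t. indicator {a..b} t *\<^sub>R g t) \<in> borel_measurable lebesgue"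
  using borel_measurable_continuous_on_indicator[OF _ assms] by (simp add: measurable_completion)

text \<open>
  The integrand, up to the factor \<open>h \<tau>\<close>, of the iterated integral over the triangle \<open>a \<le> \<tau> \<le> t \<le> x\<close>,
  extended by zero to the plane.
\<close>

definition double_kernel :: "real \<Rightarrow> real \<Rightarrow> real \<Rightarrow> real \<Rightarrow> real \<Rightarrow> real" where
  "double_kernel \<mu> \<nu> x t \<tau> =
     indicator {a..x} t * indicator {a..t} \<tau> * (kernel \<nu> x t * kernel \<mu> t \<tau>)"

text \<open>
  Tonelli's criterion, with the integration over \<open>t\<close> carried out first: it is a Beta integral, and what
  is left over \<open>\<tau>\<close> is a multiple of the integrand of order \<open>\<nu> + \<mu>\<close>, which is integrable by hypothesis.
\<close>

lemma integrable_double_kernel: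
  fixes h :: "real \<Rightarrow> complex"
  assumes h: "h absolutely_integrable_on {a..b}" and mn: "\<mu> > 0" "\<nu> > 0" and x: "x \<in> {a..b}"
    and int: "(\<lambda>t. of_real (kernel (\<nu> + \<mu>) x t) * h t) absolutely_integrable_on {a..x}"
  shows "integrable (lebesgue \<Otimes>\<^sub>M lebesgue) (\<lambda>(t, \<tau>). of_real (double_kernel \<mu> \<nu> x t \<tau>) * h \<tau>)" (is ?int)
    and "(LINT t|lebesgue. double_kernel \<mu> \<nu> x t \<tau>) = indicator {a..x} \<tau> * (Beta \<mu> \<nu> * kernel (\<nu> + \<mu>) x \<tau>)" (is ?fib)
proof -
  interpret L: sigma_finite_measure "lebesgue :: real measure"
    by (rule sigma_finite_lebesgue)
  interpret LL: pair_sigma_finite "lebesgue :: real measure" "lebesgue :: real measure" ..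
  \<comment> \<open>The scale is unconstrained outside \<open>{a..b}\<close>, so measurability requires cutting it off there.\<close>
  define \<phi>' where "\<phi>' = (\<lambda>t. indicator {a..b} t *\<^sub>R \<phi> t)"
  define w' where "w' = (\<lambda>t. indicator {a..b} t *\<^sub>R w t)"
  define h' where "h' = (\<lambda>t. indicator {a..b} t *\<^sub>R h t)"
  have [measurable]: "\<phi>' \<in> borel_measurable lebesgue" "w' \<in> borel_measurable lebesgue"
    unfolding \<phi>'_def w'_def by (rule clipped_measurable cont_scale cont_w)+
  have [measurable]: "h' \<in> borel_measurable lebesgue"
    using h unfolding h'_def set_integrable_def by (rule borel_measurable_integrable)
  have [measurable]: "(\<lambda>t::real. t) \<in> borel_measurable lebesgue"
    by (simp add: measurable_completion)
  have [measurable]: "(\<lambda>p::real \<times> real. fst p) \<in> borel_measurable (lebesgue \<Otimes>\<^sub>M lebesgue)"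
     "(\<lambda>p::real \<times> real. snd p) \<in> borel_measurable (lebesgue \<Otimes>\<^sub>M lebesgue)"
    by (rule measurable_compose[OF measurable_fst] measurable_compose[OF measurable_snd], measurable)+
  have eq: "of_real (double_kernel \<mu> \<nu> x t \<tau>) * h \<tau> =
      (if a \<le> t \<and> t \<le> x \<and> a \<le> \<tau> \<and> \<tau> \<le> t
       then of_real ((\<phi>' x - \<phi>' t) powr (\<nu> - 1) * w' t * ((\<phi>' t - \<phi>' \<tau>) powr (\<mu> - 1) * w' \<tau>)) * h' \<tau>
       else 0)" for t \<tau>
    using x by (auto simp: double_kernel_def kernel_def \<phi>'_def w'_def h'_def indicator_def)
  have meas: "(\<lambda>(\<tau>, t). of_real (double_kernel \<mu> \<nu> x t \<tau>) * h \<tau>) \<in> borel_measurable (lebesgue \<Otimes>\<^sub>M lebesgue)"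
    unfolding eq by measurable
  have F_nonneg: "0 \<le> double_kernel \<mu> \<nu> x t \<tau>" for t \<tau>
    using x kernel_nonneg by (auto simp: double_kernel_def indicator_def)
  have fib: "integrable lebesgue (\<lambda>t. double_kernel \<mu> \<nu> x t \<tau>) \<and>
     (LINT t|lebesgue. double_kernel \<mu> \<nu> x t \<tau>) = indicator {a..x} \<tau> * (Beta \<mu> \<nu> * kernel (\<nu> + \<mu>) x \<tau>)" for \<tau>
  proof (cases "\<tau> \<in> {a..x}")
    case True
    then have F: "double_kernel \<mu> \<nu> x t \<tau> = indicator {\<tau>..x} t *\<^sub>R (kernel \<nu> x t * kernel \<mu> t \<tau>)" for t
      by (auto simp: double_kernel_def indicator_def)
    have hi: "((\<lambda>t. kernel \<nu> x t * kernel \<mu> t \<tau>) has_integral Beta \<mu> \<nu> * kernel (\<nu> + \<mu>) x \<tau>) {\<tau>..x}"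
      using True x by (intro has_integral_kernel_mult_kernel mn) auto
    then have "set_integrable lebesgue {\<tau>..x} (\<lambda>t. kernel \<nu> x t * kernel \<mu> t \<tau>)"
      using True x by (intro nonnegative_absolutely_integrable_1) (auto intro!: mult_nonneg_nonneg kernel_nonneg)
    with set_lebesgue_integral_eq_integral(2)[OF this] integral_unique[OF hi] True show ?thesis
      unfolding F set_integrable_def set_lebesgue_integral_def by simp
  next
    case False
    then have "double_kernel \<mu> \<nu> x t \<tau> = 0" for t
      by (auto simp: double_kernel_def indicator_def)
    with False show ?thesis by simp
  qed
  then show ?fib by blast
  have "integrable (lebesgue \<Otimes>\<^sub>M lebesgue) (\<lambda>(\<tau>, t). of_real (double_kernel \<mu> \<nu> x t \<tau>) * h \<tau>)"
  proof (rule LL.Fubini_integrable[OF meas])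
    have "integrable lebesgue (\<lambda>\<tau>. Beta \<mu> \<nu> * norm (indicator {a..x} \<tau> *\<^sub>R (of_real (kernel (\<nu> + \<mu>) x \<tau>) * h \<tau>)))"
      using int unfolding set_integrable_def by (intro integrable_mult_right integrable_norm) simp
    also have "(\<lambda>\<tau>. Beta \<mu> \<nu> * norm (indicator {a..x} \<tau> *\<^sub>R (of_real (kernel (\<nu> + \<mu>) x \<tau>) * h \<tau>))) =
       (\<lambda>\<tau>. LINT t|lebesgue. norm (case (\<tau>, t) of (\<tau>, t) \<Rightarrow> of_real (double_kernel \<mu> \<nu> x t \<tau>) * h \<tau>))"
      using x by (auto simp: norm_mult fib F_nonneg kernel_nonneg indicator_def fun_eq_iff)
    finally show "integrable lebesgue (\<lambda>\<tau>. LINT t|lebesgue. norm (case (\<tau>, t) of (\<tau>, t) \<Rightarrow> of_real (double_kernel \<mu> \<nu> x t \<tau>) * h \<tau>))" .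
    show "AE \<tau> in lebesgue. integrable lebesgue (\<lambda>t. case (\<tau>, t) of (\<tau>, t) \<Rightarrow> of_real (double_kernel \<mu> \<nu> x t \<tau>) * h \<tau>)"
      using fib by (auto intro!: integrable_mult_left integrable_of_real)
  qed
  from LL.integrable_product_swap[OF this] show ?int
    by (simp add: case_prod_beta')
qed

lemma RL_integral_SomeI:
  assumes "x \<in> {a..b}" "negligible ({a..x} - dom g)"
     "(\<lambda>t. of_real (kernel \<mu> x t) * the (g t)) absolutely_integrable_on {a..x}"
  shows "RL_integral \<mu> g x = Some (of_real (1 / Gamma \<mu>) * integral {a..x} (\<lambda>t. of_real (kernel \<mu> x t) * the (g t)))"
  using assms by (simp add: RL_integral_def)

lemma RL_integral_dom_iff:
  "x \<in> dom (RL_integral \<mu> (Some \<circ> h)) \<longleftrightarrow>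
     x \<in> {a..b} \<and> (\<lambda>t. of_real (kernel \<mu> x t) * h t) absolutely_integrable_on {a..x}"
proof -
  have "dom (Some \<circ> h) = UNIV" by auto
  then show ?thesis by (auto simp: RL_integral_def dom_def split: if_splits)
qed

lemma RL_integral_eq:
  "x \<in> dom (RL_integral \<mu> (Some \<circ> h)) \<Longrightarrow>
   RL_integral \<mu> (Some \<circ> h) x =
     Some (of_real (1 / Gamma \<mu>) * integral {a..x} (\<lambda>t. of_real (kernel \<mu> x t) * h t))"
  by (auto simp: RL_integral_def dom_def split: if_splits)

text \<open>
  Since the inner integral of order \<open>\<mu>\<close> is defined only almost everywhere, the claim includes that it can be
  integrated again: almost every slice of the double integral is integrable, and
  such a slice at \<open>t < x\<close> is a nonzero multiple of the inner integrand.
\<close>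

lemma RL_integral_semigroup:
  assumes h: "h absolutely_integrable_on {a..b}" and mn: "\<mu> > 0" "\<nu> > 0"
    and x: "x \<in> dom (RL_integral (\<nu> + \<mu>) (Some \<circ> h))"
  shows "RL_integral \<nu> (RL_integral \<mu> (Some \<circ> h)) x = RL_integral (\<nu> + \<mu>) (Some \<circ> h) x"
proof -
  interpret L: sigma_finite_measure "lebesgue :: real measure"
    by (rule sigma_finite_lebesgue)
  interpret LL: pair_sigma_finite "lebesgue :: real measure" "lebesgue :: real measure" ..
  define F where "F = double_kernel \<mu> \<nu> x"
  define g where "g = RL_integral \<mu> (Some \<circ> h)"
  have xab: "x \<in> {a..b}" and int: "(\<lambda>t. of_real (kernel (\<nu> + \<mu>) x t) * h t) absolutely_integrable_on {a..x}"
    using x by (auto simp: RL_integral_dom_iff)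
  note F = integrable_double_kernel[OF h mn xab int, folded F_def]
  have Gammas: "Gamma \<mu> > 0" "Gamma \<nu> > 0" "Gamma (\<nu> + \<mu>) > 0"
    using mn by (auto intro: Gamma_real_pos)
  have Beta: "Beta \<mu> \<nu> / (Gamma \<mu> * Gamma \<nu>) = 1 / Gamma (\<nu> + \<mu>)"
    using Gammas by (simp add: Beta_def add.commute)
  have "AE t in lebesgue. integrable lebesgue (\<lambda>\<tau>. of_real (F t \<tau>) * h \<tau>)"
    using LL.AE_integrable_fst'[OF F(1)] by simp
  then obtain N where N: "N \<in> null_sets lebesgue"
      "{t. \<not> integrable lebesgue (\<lambda>\<tau>. of_real (F t \<tau>) * h \<tau>)} \<subseteq> N"
    by (auto simp: eventually_ae_filter)
  \<comment> \<open>At \<open>t = x\<close> the outer kernel vanishes and says nothing about the inner integral.\<close>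
  define N' where "N' = N \<union> {x}"
  have "negligible N'"
    using N(1) by (auto simp: N'_def negligible_iff_null_sets)
  have slice: "t \<in> dom g \<and> of_real (1 / Gamma \<mu>) * (LINT \<tau>|lebesgue. of_real (F t \<tau>) * h \<tau>) = of_real (kernel \<nu> x t) * the (g t)"
    if t: "t \<in> {a..x} - N'" for t
  proof -
    have tx: "t < x" "t \<in> {a..x}" "t \<in> {a..b}" and k: "kernel \<nu> x t > 0"
      using t xab by (auto simp: N'_def intro!: kernel_pos)
    have F_eq: "of_real (F t \<tau>) * h \<tau> =
        indicator {a..t} \<tau> *\<^sub>R (of_real (kernel \<nu> x t) * (of_real (kernel \<mu> t \<tau>) * h \<tau>))" for \<tau>
      using tx by (simp add: F_def double_kernel_def indicator_def)
    have "integrable lebesgue (\<lambda>\<tau>. of_real (F t \<tau>) * h \<tau>)"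
      using t N(2) by (auto simp: N'_def)
    then have "(\<lambda>\<tau>. of_real (kernel \<nu> x t) * (of_real (kernel \<mu> t \<tau>) * h \<tau>)) absolutely_integrable_on {a..t}"
      unfolding F_eq set_integrable_def .
    then have si: "(\<lambda>\<tau>. of_real (kernel \<mu> t \<tau>) * h \<tau>) absolutely_integrable_on {a..t}"
      by (rule set_integrable_mult_right_iff[THEN iffD1, rotated]) (use k in auto)
    with tx have "t \<in> dom g" by (simp add: g_def RL_integral_dom_iff)
    moreover
    have "(LINT \<tau>:{a..t}|lebesgue. of_real (kernel \<nu> x t) * (of_real (kernel \<mu> t \<tau>) * h \<tau>)) =
        of_real (kernel \<nu> x t) * integral {a..t} (\<lambda>\<tau>. of_real (kernel \<mu> t \<tau>) * h \<tau>)"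
      using set_lebesgue_integral_eq_integral(2)[OF si] by simp
    then have "(LINT \<tau>|lebesgue. of_real (F t \<tau>) * h \<tau>) =
        of_real (kernel \<nu> x t) * integral {a..t} (\<lambda>\<tau>. of_real (kernel \<mu> t \<tau>) * h \<tau>)"
      by (simp only: F_eq set_lebesgue_integral_def)
    with RL_integral_eq[OF \<open>t \<in> dom g\<close>[unfolded g_def]]
    have "of_real (1 / Gamma \<mu>) * (LINT \<tau>|lebesgue. of_real (F t \<tau>) * h \<tau>) = of_real (kernel \<nu> x t) * the (g t)"
      by (simp add: g_def)
    ultimately show ?thesis by blast
  qed
  define I where "I = (\<lambda>t. of_real (1 / Gamma \<mu>) * (LINT \<tau>|lebesgue. of_real (F t \<tau>) * h \<tau>))"
  have I_zero: "I t = 0" if "t \<notin> {a..x}" for t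
    using that by (simp add: I_def F_def double_kernel_def)
  have I_restr: "I t = indicator {a..x} t *\<^sub>R I t" for t
    using I_zero by (simp add: indicator_def)
  have "integrable lebesgue I"
    using LL.integrable_fst'[OF F(1)] unfolding I_def by (intro integrable_mult_right) simp
  then have I_int: "I absolutely_integrable_on {a..x}"
    unfolding set_integrable_def I_restr[symmetric] .
  then have kg_int: "(\<lambda>t. of_real (kernel \<nu> x t) * the (g t)) absolutely_integrable_on {a..x}"
    by (rule absolutely_integrable_spike[OF _ \<open>negligible N'\<close>]) (use slice in \<open>simp add: I_def\<close>)
  have neg: "negligible ({a..x} - dom g)"
    using slice by (intro negligible_subset[OF \<open>negligible N'\<close>]) blast
  have "integral {a..x} (\<lambda>t. of_real (kernel \<nu> x t) * the (g t)) = integral {a..x} I"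
    by (rule integral_spike[OF \<open>negligible N'\<close>]) (use slice in \<open>auto simp: I_def\<close>)
  also have "\<dots> = (LINT t|lebesgue. I t)"
    using set_lebesgue_integral_eq_integral(2)[OF I_int]
    unfolding set_lebesgue_integral_def I_restr[symmetric] by simp
  also have "\<dots> = of_real (1 / Gamma \<mu>) * (LINT \<tau>|lebesgue. LINT t|lebesgue. of_real (F t \<tau>) * h \<tau>)"
    unfolding I_def using LL.Fubini_integral[OF F(1)] by simp
  also have "(LINT \<tau>|lebesgue. LINT t|lebesgue. of_real (F t \<tau>) * h \<tau>) =
     (LINT \<tau>:{a..x}|lebesgue. of_real (Beta \<mu> \<nu>) * (of_real (kernel (\<nu> + \<mu>) x \<tau>) * h \<tau>))"
    unfolding set_lebesgue_integral_def
    by (intro Bochner_Integration.integral_cong) (auto simp: F(2) indicator_def)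
  also have "\<dots> = of_real (Beta \<mu> \<nu>) * integral {a..x} (\<lambda>\<tau>. of_real (kernel (\<nu> + \<mu>) x \<tau>) * h \<tau>)"
    using set_lebesgue_integral_eq_integral(2)[OF int] by simp
  finally have "integral {a..x} (\<lambda>t. of_real (kernel \<nu> x t) * the (g t)) =
     of_real (1 / Gamma \<mu>) * (of_real (Beta \<mu> \<nu>) * integral {a..x} (\<lambda>\<tau>. of_real (kernel (\<nu> + \<mu>) x \<tau>) * h \<tau>))" .
  then have "of_real (1 / Gamma \<nu>) * integral {a..x} (\<lambda>t. of_real (kernel \<nu> x t) * the (g t)) =
     of_real (Beta \<mu> \<nu> / (Gamma \<mu> * Gamma \<nu>)) * integral {a..x} (\<lambda>\<tau>. of_real (kernel (\<nu> + \<mu>) x \<tau>) * h \<tau>)"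
    by simp
  then show ?thesis
    unfolding Beta RL_integral_eq[OF x]
    using RL_integral_SomeI[OF xab neg kg_int] by (simp add: g_def)
qed

section \<open>Differentiating a fractional integral\<close>

text \<open>
  Orders \<open>\<kappa> \<ge> 1\<close> have a bounded kernel, so mere integrability of \<open>h\<close> suffices.
\<close>

lemma RL_integral_dom_ge_1:
  assumes h: "h absolutely_integrable_on {a..b}" and \<kappa>: "\<kappa> \<ge> 1" and x: "x \<in> {a..b}"
  shows "x \<in> dom (RL_integral \<kappa> (Some \<circ> h))"
proof -
  have sub: "{a..x} \<subseteq> {a..b}" using x by auto
  note cont = cont_scale[THEN continuous_on_subset, OF sub] cont_w[THEN continuous_on_subset, OF sub]
  have [measurable]: "\<phi> \<in> borel_measurable (lebesgue_on {a..x})" "w \<in> borel_measurable (lebesgue_on {a..x})"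
    using cont by (auto intro: continuous_imp_measurable_on_sets_lebesgue)
  have meas: "kernel \<kappa> x \<in> borel_measurable (lebesgue_on {a..x})"
    unfolding kernel_def by measurable
  obtain W where W: "\<And>t. t \<in> {a..x} \<Longrightarrow> norm (w t) \<le> W"
    using compact_imp_bounded[OF compact_continuous_image[OF cont(2)]] by (fastforce simp: bounded_iff)
  have "norm (kernel \<kappa> x t) \<le> (\<phi> b - \<phi> a) powr (\<kappa> - 1) * W" if t: "t \<in> {a..x}" for t
  proof -
    have "\<phi> a \<le> \<phi> t" "\<phi> t \<le> \<phi> x" "\<phi> x \<le> \<phi> b"
      using t x by (auto intro!: scale_le)
    then have "(\<phi> x - \<phi> t) powr (\<kappa> - 1) \<le> (\<phi> b - \<phi> a) powr (\<kappa> - 1)"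
      using \<kappa> by (intro powr_mono2) auto
    then show ?thesis
      unfolding kernel_def norm_mult using W[OF t] by (intro mult_mono) auto
  qed
  then have "bounded (kernel \<kappa> x ` {a..x})"
    unfolding bounded_iff by blast
  moreover have "bilinear (scaleR :: real \<Rightarrow> complex \<Rightarrow> complex)"
    by (simp add: bilinear_conv_bounded_bilinear bounded_bilinear_scaleR)
  ultimately have "(\<lambda>t. kernel \<kappa> x t *\<^sub>R h t) absolutely_integrable_on {a..x}"
    using meas absolutely_integrable_on_subinterval[OF h sub]
      absolutely_integrable_bounded_measurable_product[of scaleR "kernel \<kappa> x" "{a..x}" h]
    by auto
  with x show ?thesis by (simp add: RL_integral_dom_iff scaleR_conv_of_real)
qed

text \<open>
  Differentiability at \<open>x\<close> is a hypothesis, so the derivative may be computed along a single sequence \<open>y\<close>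
  that increases to \<open>x\<close>. From the left, the difference quotients of the kernel are dominated by a multiple of the
  kernel of order \<open>\<kappa>\<close> at \<open>x\<close>, whose integral converges by hypothesis; for \<open>\<kappa> < 1\<close> no such domination is
  available from the right. This is where \<open>x > a\<close> enters.
\<close>

lemma scale_deriv_RL_integral:
  assumes h: "h absolutely_integrable_on {a..b}" and \<kappa>: "\<kappa> > 0" and x: "x \<in> {a<..b}"
    and dom: "x \<in> dom (RL_integral \<kappa> (Some \<circ> h))"
    and diff: "x \<in> dom (scale_deriv (RL_integral (1 + \<kappa>) (Some \<circ> h)))"
  shows "scale_deriv (RL_integral (1 + \<kappa>) (Some \<circ> h)) x = RL_integral \<kappa> (Some \<circ> h) x"
proof -
  define u where "u = (\<lambda>t. the (RL_integral (1 + \<kappa>) (Some \<circ> h) t))"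
  define c where "c = (1 / Gamma (1 + \<kappa>))"
  define D where "D = vector_derivative u (at x within {a..b})"
  define y where "y = (\<lambda>n::nat. x - (x - a) / (real n + 2))"
  \<comment> \<open>Truncating the kernel at \<open>y\<close> lets all integrals run over the same interval \<open>{a..x}\<close>.\<close>
  define k where "k = (\<lambda>y \<tau>. if \<tau> \<in> {a..y} then (\<phi> y - \<phi> \<tau>) powr \<kappa> else 0)"
  have xab: "x \<in> {a..b}" using x by auto
  have Gamma_pos: "Gamma (1 + \<kappa>) > 0" using \<kappa> by (intro Gamma_real_pos) auto
  have val: "scale_deriv (RL_integral (1 + \<kappa>) (Some \<circ> h)) x = Some (of_real (1 / w x) * D)"
    and "u differentiable (at x within {a..b})"
    using diff unfolding u_def D_def
    by (auto simp: scale_deriv_def partial_mult_def partial_deriv_def dom_def split: if_splits)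
  then have "(u has_vector_derivative D) (at x within {a..b})"
    unfolding D_def by (simp add: vector_derivative_works)
  then have quot: "((\<lambda>t. (u t - u x) /\<^sub>R (t - x)) \<longlongrightarrow> D) (at x within {a..b})"
    by (rule has_vector_derivative_tendsto_quotient)
  have y: "y n \<in> {a..b}" "a < y n" "y n < x" for n
  proof -
    have "(x - a) * 1 < (x - a) * (real n + 2)"
      using x by (intro mult_strict_left_mono) auto
    then have "(x - a) / (real n + 2) < x - a" "0 < (x - a) / (real n + 2)"
      using x by (auto simp: divide_less_eq)
    then show "a < y n" "y n < x" by (auto simp: y_def)
    with x show "y n \<in> {a..b}" by auto
  qed
  have "y \<longlonglongrightarrow> x"
    unfolding y_def by real_asymp
  then have y_lim: "filterlim y (at x within {a..b}) sequentially"
    unfolding filterlim_at using y by (auto intro!: always_eventually simp: less_imp_neq)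
  have slope_lim: "(\<lambda>n. (g (y n) - g x) / (y n - x)) \<longlonglongrightarrow> d"
    if "(g has_real_derivative d) (at x within {a..b})" for g d
    using that unfolding has_field_derivative_iff by (rule filterlim_compose[OF _ y_lim])
  define H where "H = (\<lambda>\<tau>. of_real (kernel \<kappa> x \<tau>) * h \<tau>)"
  have H: "H absolutely_integrable_on {a..x}"
    using dom by (simp add: RL_integral_dom_iff H_def)
  have k_int: "((\<lambda>\<tau>. of_real (k t \<tau> * w \<tau>) * h \<tau>) has_integral u t / c) {a..x}"
    if t: "t \<in> {a..x}" for t
  proof -
    have "t \<in> {a..b}" using t x by auto
    then have td: "t \<in> dom (RL_integral (1 + \<kappa>) (Some \<circ> h))"
      using \<kappa> by (intro RL_integral_dom_ge_1[OF h]) auto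
    then have "(\<lambda>\<tau>. of_real (kernel (1 + \<kappa>) t \<tau>) * h \<tau>) integrable_on {a..t}"
      by (simp add: RL_integral_dom_iff set_lebesgue_integral_eq_integral(1))
    moreover have "u t / c = integral {a..t} (\<lambda>\<tau>. of_real (kernel (1 + \<kappa>) t \<tau>) * h \<tau>)"
      using Gamma_pos unfolding u_def RL_integral_eq[OF td] c_def by simp
    ultimately have "((\<lambda>\<tau>. of_real (kernel (1 + \<kappa>) t \<tau>) * h \<tau>) has_integral u t / c) {a..t}"
      by (simp add: integrable_integral)
    then have "((\<lambda>\<tau>. if \<tau> \<in> {a..t} then of_real (kernel (1 + \<kappa>) t \<tau>) * h \<tau> else 0) has_integral u t / c) {a..x}"
      using t by (subst has_integral_restrict) auto
    also have "(\<lambda>\<tau>. if \<tau> \<in> {a..t} then of_real (kernel (1 + \<kappa>) t \<tau>) * h \<tau> else 0) =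
       (\<lambda>\<tau>. of_real (k t \<tau> * w \<tau>) * h \<tau>)"
      by (auto simp: k_def kernel_def)
    finally show ?thesis .
  qed
  define f where "f = (\<lambda>n \<tau>. of_real ((k x \<tau> - k (y n) \<tau>) / (x - y n) * w \<tau>) * h \<tau>)"
  have f_int: "(f n has_integral (u x - u (y n)) / c / (x - y n)) {a..x}" for n
  proof -
    have "((\<lambda>\<tau>. (of_real (k x \<tau> * w \<tau>) * h \<tau> - of_real (k (y n) \<tau> * w \<tau>) * h \<tau>) / (x - y n))
       has_integral (u x / c - u (y n) / c) / (x - y n)) {a..x}"
      using y[of n] x by (intro has_integral_divide has_integral_diff k_int) auto
    also have "(\<lambda>\<tau>. (of_real (k x \<tau> * w \<tau>) * h \<tau> - of_real (k (y n) \<tau> * w \<tau>) * h \<tau>) / (x - y n)) = f n"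
      by (auto simp: f_def fun_eq_iff diff_divide_distrib algebra_simps)
    finally show ?thesis by (simp add: diff_divide_distrib)
  qed
  \<comment> \<open>The slopes of the scale converge to \<open>w x\<close>; their bound \<open>C\<close> enters the dominating function.\<close>
  have "Bseq (\<lambda>n. (\<phi> (y n) - \<phi> x) / (y n - x))"
    using slope_lim[OF deriv_scale[OF xab]] convergent_def convergent_imp_Bseq by blast
  then obtain C where C: "C > 0" "\<And>n. norm ((\<phi> (y n) - \<phi> x) / (y n - x)) \<le> C"
    unfolding Bseq_def by blast
  have f_le: "norm (f n \<tau>) \<le> (C * max 1 \<kappa>) * norm (H \<tau>)" if \<tau>: "\<tau> \<in> {a..x}" for n \<tau>
  proof (cases "\<tau> = x")
    case True
    then show ?thesis using y[of n] C by (simp add: f_def k_def H_def)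
  next
    case False
    \<comment> \<open>The truncated kernel is \<open>v powr \<kappa>\<close> on both sides of \<open>y n\<close>, so one inequality covers both.\<close>
    define v where "v = max 0 (\<phi> (y n) - \<phi> \<tau>)"
    have \<tau>': "\<tau> \<in> {a..b}" "\<tau> < x" using \<tau> x False by auto
    have kx: "k x \<tau> = (\<phi> x - \<phi> \<tau>) powr \<kappa>"
      using \<tau> by (simp add: k_def)
    have ky: "k (y n) \<tau> = v powr \<kappa>"
      using scale_le[of "y n" \<tau>] scale_le[of \<tau> "y n"] y[of n] \<tau> \<tau>' by (auto simp: k_def v_def max_def)
    have lt: "0 < \<phi> x - \<phi> \<tau>" "\<phi> (y n) < \<phi> x"
      using scale_less[of \<tau> x] scale_less[of "y n" x] \<tau>' xab y[of n] by auto
    have "v powr \<kappa> \<le> (\<phi> x - \<phi> \<tau>) powr \<kappa>"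
      using lt \<kappa> by (intro powr_mono2) (auto simp: v_def)
    then have "\<bar>k x \<tau> - k (y n) \<tau>\<bar> = (\<phi> x - \<phi> \<tau>) powr \<kappa> - v powr \<kappa>"
      by (simp add: kx ky)
    also have "\<dots> \<le> max 1 \<kappa> * (\<phi> x - \<phi> \<tau> - v) * (\<phi> x - \<phi> \<tau>) powr (\<kappa> - 1)"
      using lt \<kappa> by (intro powr_diff_le) (auto simp: v_def)
    also have "\<dots> \<le> max 1 \<kappa> * (\<phi> x - \<phi> (y n)) * (\<phi> x - \<phi> \<tau>) powr (\<kappa> - 1)"
      by (intro mult_mono mult_nonneg_nonneg) (use lt in \<open>auto simp: v_def\<close>)
    also have "\<phi> x - \<phi> (y n) \<le> C * (x - y n)"
      using C(2)[of n] y[of n] lt by (simp add: field_simps abs_if)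
    finally have "\<bar>k x \<tau> - k (y n) \<tau>\<bar> \<le> max 1 \<kappa> * (C * (x - y n)) * (\<phi> x - \<phi> \<tau>) powr (\<kappa> - 1)"
      by (simp add: mult_left_mono mult_right_mono)
    then have "\<bar>k x \<tau> - k (y n) \<tau>\<bar> / (x - y n) \<le> C * max 1 \<kappa> * (\<phi> x - \<phi> \<tau>) powr (\<kappa> - 1)"
      using y[of n] by (simp add: field_simps)
    then have "(\<bar>k x \<tau> - k (y n) \<tau>\<bar> / (x - y n)) * (w \<tau> * norm (h \<tau>)) \<le>
        (C * max 1 \<kappa> * (\<phi> x - \<phi> \<tau>) powr (\<kappa> - 1)) * (w \<tau> * norm (h \<tau>))"
      using w_pos[OF \<tau>'(1)] by (intro mult_right_mono) auto
    moreover have "norm (f n \<tau>) = (\<bar>k x \<tau> - k (y n) \<tau>\<bar> / (x - y n)) * (w \<tau> * norm (h \<tau>))"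
      unfolding f_def norm_mult norm_of_real using y[of n] w_pos[OF \<tau>'(1)] by (simp add: abs_mult)
    moreover have "norm (H \<tau>) = (\<phi> x - \<phi> \<tau>) powr (\<kappa> - 1) * (w \<tau> * norm (h \<tau>))"
      unfolding H_def kernel_def norm_mult norm_of_real using w_pos[OF \<tau>'(1)] by (simp add: abs_mult)
    ultimately show ?thesis by (simp add: mult.assoc)
  qed
  have f_lim: "(\<lambda>n. f n \<tau>) \<longlonglongrightarrow> of_real (\<kappa> * w x) * H \<tau>" if \<tau>: "\<tau> \<in> {a..x}" for \<tau>
  proof (cases "\<tau> = x")
    case True
    then have "f n \<tau> = 0" for n using y[of n] by (simp add: f_def k_def)
    then show ?thesis using True by (simp add: H_def)
  next
    case False
    then have \<tau>': "\<tau> < x" "\<tau> \<in> {a..b}" using \<tau> x by auto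
    have swap: "(p - q) / (r - s) = (q - p) / (s - r)" for p q r s :: real
      by (metis minus_diff_eq minus_divide_divide)
    have "((\<lambda>t. (\<phi> t - \<phi> \<tau>) powr \<kappa>) has_real_derivative \<kappa> * (\<phi> x - \<phi> \<tau>) powr (\<kappa> - 1) * w x) (at x within {a..b})"
      using scale_less[of \<tau> x] \<tau>' xab
      by (auto intro!: derivative_eq_intros deriv_scale simp: powr_diff)
    from slope_lim[OF this]
    have "(\<lambda>n. ((\<phi> (y n) - \<phi> \<tau>) powr \<kappa> - (\<phi> x - \<phi> \<tau>) powr \<kappa>) / (y n - x)) \<longlonglongrightarrow> \<kappa> * (\<phi> x - \<phi> \<tau>) powr (\<kappa> - 1) * w x" .
    moreover have "\<forall>\<^sub>F n in sequentially. \<tau> < y n"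
      using \<open>y \<longlonglongrightarrow> x\<close> \<tau>' by (auto simp: order_tendsto_iff)
    then have "\<forall>\<^sub>F n in sequentially. ((\<phi> (y n) - \<phi> \<tau>) powr \<kappa> - (\<phi> x - \<phi> \<tau>) powr \<kappa>) / (y n - x) =
        (k x \<tau> - k (y n) \<tau>) / (x - y n)"
      by eventually_elim (use \<tau> y in \<open>auto simp: k_def intro: swap\<close>)
    ultimately have "(\<lambda>n. (k x \<tau> - k (y n) \<tau>) / (x - y n)) \<longlonglongrightarrow> \<kappa> * (\<phi> x - \<phi> \<tau>) powr (\<kappa> - 1) * w x"
      by (rule Lim_transform_eventually)
    then have "(\<lambda>n. f n \<tau>) \<longlonglongrightarrow> of_real (\<kappa> * (\<phi> x - \<phi> \<tau>) powr (\<kappa> - 1) * w x * w \<tau>) * h \<tau>"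
      unfolding f_def by (intro tendsto_intros)
    then show ?thesis by (simp add: H_def kernel_def mult_ac)
  qed
  have "(\<lambda>n. (u x - u (y n)) / c / (x - y n)) \<longlonglongrightarrow> integral {a..x} (\<lambda>\<tau>. of_real (\<kappa> * w x) * H \<tau>)"
  proof -
    have "(\<lambda>n. integral {a..x} (f n)) \<longlonglongrightarrow> integral {a..x} (\<lambda>\<tau>. of_real (\<kappa> * w x) * H \<tau>)"
    proof (rule dominated_convergence(2)[OF _ _ f_le f_lim])
      show "f n integrable_on {a..x}" for n using f_int by blast
      show "(\<lambda>\<tau>. C * max 1 \<kappa> * norm (H \<tau>)) integrable_on {a..x}"
        using H by (intro integrable_on_mult_right) (auto simp: absolutely_integrable_on_def)
    qed
    then show ?thesis by (simp add: integral_unique[OF f_int])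
  qed
  then have "(\<lambda>n. of_real c * ((u x - u (y n)) / c / (x - y n))) \<longlonglongrightarrow> of_real c * integral {a..x} (\<lambda>\<tau>. of_real (\<kappa> * w x) * H \<tau>)"
    by (rule tendsto_mult_left)
  moreover have "of_real c * ((u x - u (y n)) / c / (x - y n)) = (u (y n) - u x) /\<^sub>R (y n - x)" for n
    using Gamma_pos y[of n]
    by (simp add: c_def scaleR_conv_of_real field_simps)
  moreover have "(\<lambda>n. (u (y n) - u x) /\<^sub>R (y n - x)) \<longlonglongrightarrow> D"
    by (rule filterlim_compose[OF quot y_lim])
  ultimately have "D = of_real c * integral {a..x} (\<lambda>\<tau>. of_real (\<kappa> * w x) * H \<tau>)"
    using LIMSEQ_unique by simp
  also have "\<dots> = of_real (c * \<kappa> * w x) * integral {a..x} H"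
    by simp
  also have "c * \<kappa> = 1 / Gamma \<kappa>"
    using \<kappa> Gamma_plus1[of \<kappa>] by (simp add: c_def add.commute nonpos_Ints_def)
  finally have "of_real (1 / w x) * D = of_real (1 / Gamma \<kappa>) * integral {a..x} H"
    using w_pos[OF xab] by simp
  then show ?thesis
    by (simp add: val RL_integral_eq[OF dom] H_def)
qed

lemma dom_scale_deriv: "dom (scale_deriv g) = dom (partial_deriv a b g)"
  by (simp add: scale_deriv_def)

lemma scale_deriv_pow_cong:
  assumes "open U" "\<And>t. t \<in> U \<inter> {a..b} \<Longrightarrow> g1 t = g2 t" "x \<in> U \<inter> {a..b}"
  shows "(scale_deriv ^^ n) g1 x = (scale_deriv ^^ n) g2 x"
  using assms(3)
proof (induction n arbitrary: x)
  case (Suc n)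
  then have "partial_deriv a b ((scale_deriv ^^ n) g1) x = partial_deriv a b ((scale_deriv ^^ n) g2) x"
    using assms(1) by (intro partial_deriv_cong[of U]) blast+
  then have "scale_deriv ((scale_deriv ^^ n) g1) x = scale_deriv ((scale_deriv ^^ n) g2) x"
    by (simp only: scale_deriv_def[of "(scale_deriv ^^ n) g1"] scale_deriv_def[of "(scale_deriv ^^ n) g2"]
        partial_mult_def)
  then show ?case by simp
qed (use assms in auto)

lemma scale_deriv_pow_dom_nhd:
  assumes "x \<in> dom ((scale_deriv ^^ n) g)" "n > 0"
  obtains U where "open U" "x \<in> U" "U \<inter> {a..b} \<subseteq> dom g"
proof -
  have "\<exists>U. open U \<and> x \<in> U \<and> U \<inter> {a..b} \<subseteq> dom g"
    using assms
  proof (induction n)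
    case (Suc n)
    then have "x \<in> dom (partial_deriv a b ((scale_deriv ^^ n) g))"
      by (simp add: dom_scale_deriv)
    then obtain U where U: "open U" "x \<in> U" "U \<inter> {a..b} \<subseteq> dom ((scale_deriv ^^ n) g)"
      by (rule partial_deriv_dom_nhd)
    have "x \<in> {a..b}"
      using \<open>x \<in> dom (partial_deriv _ _ _)\<close> by (auto simp: partial_deriv_def dom_def split: if_splits)
    then have "x \<in> dom ((scale_deriv ^^ n) g)" using U by blast
    with Suc.IH U show ?case by (cases "n = 0") (simp, blast, blast)
  qed simp
  with that show ?thesis by blast
qed

section \<open>Composition of derivatives and integrals\<close>

text \<open>
  In the induction step the inner expression must be simplified on a whole neighbourhood of \<open>x\<close>
  before the outermost derivative is taken. There the order is \<open>1 + \<kappa> \<ge> 1\<close>, so the right-hand side is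
  defined everywhere; hence the induction is over all \<open>\<kappa>\<close>.
\<close>

lemma scale_deriv_pow_RL_integral:
  assumes h: "h absolutely_integrable_on {a..b}" and "\<kappa> > 0" and "x \<in> {a<..b}"
    and "x \<in> dom (RL_integral \<kappa> (Some \<circ> h))"
    and "x \<in> dom ((scale_deriv ^^ n) (RL_integral (real n + \<kappa>) (Some \<circ> h)))"
  shows "(scale_deriv ^^ n) (RL_integral (real n + \<kappa>) (Some \<circ> h)) x = RL_integral \<kappa> (Some \<circ> h) x"
  using assms(2-)
proof (induction n arbitrary: \<kappa> x)
  case (Suc n)
  let ?J = "\<lambda>\<mu>. RL_integral \<mu> (Some \<circ> h)"
  let ?G = "(scale_deriv ^^ n) (?J (real n + (1 + \<kappa>)))"
  have eq: "(scale_deriv ^^ Suc n) (?J (real (Suc n) + \<kappa>)) = scale_deriv ?G"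
    by (simp add: algebra_simps)
  have "x \<in> dom (partial_deriv a b ?G)"
    using Suc.prems unfolding eq by (simp add: dom_scale_deriv)
  then obtain U where U: "open U" "x \<in> U" "U \<inter> {a..b} \<subseteq> dom ?G"
    by (rule partial_deriv_dom_nhd)
  have "?G t = ?J (1 + \<kappa>) t" if "t \<in> (U \<inter> {a<..}) \<inter> {a..b}" for t
  proof (rule Suc.IH)
    show "0 < 1 + \<kappa>" "t \<in> {a<..b}" using that Suc.prems(1) by auto
    show "t \<in> dom (?J (1 + \<kappa>))" using that Suc.prems(1) by (intro RL_integral_dom_ge_1[OF h]) auto
    show "t \<in> dom ?G" using that U by blast
  qed
  moreover have "open (U \<inter> {a<..})" "x \<in> (U \<inter> {a<..}) \<inter> {a..b}"
    using U Suc.prems by auto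
  ultimately have cong: "scale_deriv ?G x = scale_deriv (?J (1 + \<kappa>)) x"
    using scale_deriv_pow_cong[of "U \<inter> {a<..}" ?G "?J (1 + \<kappa>)" x 1] by simp
  have "x \<in> dom (scale_deriv (?J (1 + \<kappa>)))"
    using Suc.prems(4) cong unfolding eq by (simp add: domIff)
  with Suc.prems have "scale_deriv (?J (1 + \<kappa>)) x = ?J \<kappa> x"
    by (intro scale_deriv_RL_integral h)
  with cong show ?case unfolding eq by (rule trans)
qed simp

text \<open>
  Independence of the number \<open>n\<close> of derivatives. For \<open>\<rho> \<ge> 0\<close> the definition uses the smallest admissible number
  \<open>m\<close>; the other \<open>n - m\<close> derivatives are applied first and cancel near \<open>x\<close>, where both functions are
  defined because \<open>m \<ge> 1\<close> derivatives of each exist at \<open>x\<close>.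
\<close>

lemma RL_op_eq:
  assumes h: "h absolutely_integrable_on {a..b}" and n: "real n > \<rho>" "n > 0" and x: "x \<in> {a<..b}"
    and dom: "x \<in> dom ((scale_deriv ^^ n) (RL_integral (real n - \<rho>) (Some \<circ> h)))"
    and dom': "x \<in> dom (RL_op \<rho> (Some \<circ> h))"
  shows "(scale_deriv ^^ n) (RL_integral (real n - \<rho>) (Some \<circ> h)) x = RL_op \<rho> (Some \<circ> h) x"
proof (cases "\<rho> < 0")
  case True
  then show ?thesis
    using scale_deriv_pow_RL_integral[OF h, of "- \<rho>" x n] assms by (simp add: RL_op_def)
next
  case False
  define m where "m = nat \<lfloor>\<rho>\<rfloor> + 1"
  let ?J = "\<lambda>\<mu>. RL_integral \<mu> (Some \<circ> h)"
  have m: "real m > \<rho>" "m \<le> n" "m > 0"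
    using False n by (auto simp: m_def) linarith+
  have op: "RL_op \<rho> (Some \<circ> h) = (scale_deriv ^^ m) (?J (real m - \<rho>))"
    using False by (simp add: RL_op_def m_def Let_def)
  define k where "k = n - m"
  let ?G = "(scale_deriv ^^ k) (?J (real k + (real m - \<rho>)))"
  have n_eq: "n = m + k" using m by (simp add: k_def)
  have G: "(scale_deriv ^^ n) (?J (real n - \<rho>)) = (scale_deriv ^^ m) ?G"
    unfolding n_eq funpow_add by (simp add: algebra_simps)
  obtain U where U: "open U" "x \<in> U" "U \<inter> {a..b} \<subseteq> dom ?G"
    by (rule scale_deriv_pow_dom_nhd[OF dom[unfolded G] m(3)])
  obtain V where V: "open V" "x \<in> V" "V \<inter> {a..b} \<subseteq> dom (?J (real m - \<rho>))"
    by (rule scale_deriv_pow_dom_nhd[OF dom'[unfolded op] m(3)])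
  show ?thesis
    unfolding op G
  proof (rule scale_deriv_pow_cong)
    show "open (U \<inter> V \<inter> {a<..})" "x \<in> (U \<inter> V \<inter> {a<..}) \<inter> {a..b}"
      using U V x by auto
    show "?G t = ?J (real m - \<rho>) t" if "t \<in> (U \<inter> V \<inter> {a<..}) \<inter> {a..b}" for t
      using that U V m by (intro scale_deriv_pow_RL_integral h) auto
  qed
qed

text \<open>
  The two inner integrals are merged near \<open>x\<close> by the semigroup law, which needs the integral of order
  \<open>n - \<mu> + \<nu>\<close> to be defined there. If this order is less than \<open>1\<close>, the operator of order \<open>\<mu> - \<nu>\<close> is a derivative
  that also takes \<open>n\<close> derivatives of this very integral, so its existence at \<open>x\<close> gives what is needed.
\<close>

lemma RL_op_RL_integral:
  assumes h: "h absolutely_integrable_on {a..b}" and \<nu>: "\<nu> > 0" and x: "x \<in> {a<..b}"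
    and dom: "x \<in> dom (RL_op \<mu> (RL_integral \<nu> (Some \<circ> h)))"
    and dom': "x \<in> dom (RL_op (\<mu> - \<nu>) (Some \<circ> h))"
  shows "RL_op \<mu> (RL_integral \<nu> (Some \<circ> h)) x = RL_op (\<mu> - \<nu>) (Some \<circ> h) x"
proof (cases "\<mu> < 0")
  case True
  then show ?thesis
    using RL_integral_semigroup[OF h, of \<nu> "- \<mu>" x] \<nu> dom' by (simp add: RL_op_def algebra_simps)
next
  case False
  define n where "n = nat \<lfloor>\<mu>\<rfloor> + 1"
  let ?J = "\<lambda>\<mu>. RL_integral \<mu> (Some \<circ> h)"
  have n: "real n > \<mu>" "n > 0"
    using False by (auto simp: n_def) linarith
  have op: "RL_op \<mu> g = (scale_deriv ^^ n) (RL_integral (real n - \<mu>) g)" for g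
    using False by (simp add: RL_op_def n_def Let_def)
  have "\<exists>U. open U \<and> x \<in> U \<and> U \<inter> {a..b} \<subseteq> dom (?J (real n - \<mu> + \<nu>))"
  proof (cases "real n - \<mu> + \<nu> \<ge> 1")
    case True
    then have "{a..b} \<subseteq> dom (?J (real n - \<mu> + \<nu>))"
      using RL_integral_dom_ge_1[OF h] by blast
    then show ?thesis by (intro exI[of _ UNIV]) simp
  next
    case False
    then have "\<not> \<mu> - \<nu> < 0" "nat \<lfloor>\<mu> - \<nu>\<rfloor> + 1 = n"
      using \<nu> \<open>\<not> \<mu> < 0\<close> by (auto simp: n_def) linarith+
    then have "x \<in> dom ((scale_deriv ^^ n) (?J (real n - (\<mu> - \<nu>))))"
      using dom' by (simp add: RL_op_def Let_def)
    from scale_deriv_pow_dom_nhd[OF this n(2)] show ?thesis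
      by (metis diff_diff_eq2 diff_add_eq)
  qed
  then obtain U where U: "open U" "x \<in> U" "U \<inter> {a..b} \<subseteq> dom (?J (real n - \<mu> + \<nu>))"
    by blast
  have eq: "RL_op \<mu> (?J \<nu>) x = (scale_deriv ^^ n) (?J (real n - (\<mu> - \<nu>))) x"
    unfolding op
  proof (rule scale_deriv_pow_cong[OF U(1)])
    fix t assume "t \<in> U \<inter> {a..b}"
    then show "RL_integral (real n - \<mu>) (?J \<nu>) t = ?J (real n - (\<mu> - \<nu>)) t"
      using RL_integral_semigroup[OF h \<nu>, of "real n - \<mu>" t] n U by (simp add: diff_diff_eq2 diff_add_eq subset_iff)
  qed (use U x in auto)
  also have "\<dots> = RL_op (\<mu> - \<nu>) (Some \<circ> h) x"
    using dom dom' eq n \<nu> by (intro RL_op_eq h x) (auto simp: dom_def)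
  finally show ?thesis .
qed

text \<open>
  For \<open>\<mu> \<ge> 0\<close> both sides are the same expression; for \<open>\<mu> < 0\<close> they differ in the number
  of derivatives.
\<close>

lemma scale_deriv_pow_RL_op:
  assumes h: "h absolutely_integrable_on {a..b}" and n: "n > 0" and x: "x \<in> {a<..b}"
    and dom: "x \<in> dom ((scale_deriv ^^ n) (RL_op \<mu> (Some \<circ> h)))"
    and dom': "x \<in> dom (RL_op (real n + \<mu>) (Some \<circ> h))"
  shows "(scale_deriv ^^ n) (RL_op \<mu> (Some \<circ> h)) x = RL_op (real n + \<mu>) (Some \<circ> h) x"
proof (cases "\<mu> < 0")
  case True
  then show ?thesis
    using RL_op_eq[OF h _ n x, of "real n + \<mu>"] dom dom' by (simp add: RL_op_def[of \<mu>])
next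
  case False
  define m where "m = nat \<lfloor>\<mu>\<rfloor> + 1"
  have pow: "(scale_deriv ^^ (n + m)) g = (scale_deriv ^^ n) ((scale_deriv ^^ m) g)" for g
    by (simp add: funpow_add)
  have "nat \<lfloor>real n + \<mu>\<rfloor> + 1 = n + m"
    using False by (simp add: nat_add_distrib m_def)
  then have "RL_op (real n + \<mu>) (Some \<circ> h) =
      (scale_deriv ^^ (n + m)) (RL_integral (real (n + m) - (real n + \<mu>)) (Some \<circ> h))"
    using False by (simp add: RL_op_def Let_def)
  also have "real (n + m) - (real n + \<mu>) = real m - \<mu>" by simp
  finally have "RL_op (real n + \<mu>) (Some \<circ> h) =
      (scale_deriv ^^ n) ((scale_deriv ^^ m) (RL_integral (real m - \<mu>) (Some \<circ> h)))"
    unfolding pow .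
  moreover have "RL_op \<mu> (Some \<circ> h) = (scale_deriv ^^ m) (RL_integral (real m - \<mu>) (Some \<circ> h))"
    using False by (simp add: RL_op_def Let_def m_def)
  ultimately show ?thesis by simp
qed

end

section \<open>Reduction of the Hadamard-type operators\<close>

lemma of_real_powr_eq_exp:
  "r > 0 \<Longrightarrow> complex_of_real r powr s = exp (s * of_real (ln r))"
  by (simp add: powr_def Ln_of_real)

lemma of_real_divide_powr:
  assumes "p > 0" "q > 0"
  shows "complex_of_real (p / q) powr s = of_real q powr (- s) * of_real p powr s"
proof -
  have "complex_of_real (p / q) powr s = exp (s * of_real (ln (p / q)))"
    using assms by (intro of_real_powr_eq_exp) auto
  then show ?thesis
    using assms by (simp add: of_real_powr_eq_exp ln_div exp_add[symmetric] algebra_simps)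
qed

locale hadamard_setting =
  fixes a b :: real and \<Psi> \<Psi>' :: "real \<Rightarrow> real"
  assumes ab: "a < b"
    and deriv_Psi: "\<And>x. x \<in> {a..b} \<Longrightarrow> (\<Psi> has_real_derivative \<Psi>' x) (at x within {a..b})"
    and cont_Psi': "continuous_on {a..b} \<Psi>'"
    and Psi_pos: "\<And>x. x \<in> {a..b} \<Longrightarrow> \<Psi> x > 0"
    and mono_Psi: "mono_on {a..b} \<Psi>"
    and Psi'_nonzero: "\<And>x. x \<in> {a..b} \<Longrightarrow> \<Psi>' x \<noteq> 0"
begin

lemma cont_Psi: "continuous_on {a..b} \<Psi>"
  by (meson deriv_Psi DERIV_continuous continuous_on_eq_continuous_within)

lemma Psi'_pos:
  assumes x: "x \<in> {a..b}"
  shows "\<Psi>' x > 0"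
proof -
  have "((\<lambda>y. (\<Psi> y - \<Psi> x) / (y - x)) \<longlongrightarrow> \<Psi>' x) (at x within {a..b})"
    using deriv_Psi[OF x] by (simp add: has_field_derivative_iff)
  moreover have "\<forall>\<^sub>F y in at x within {a..b}. 0 \<le> (\<Psi> y - \<Psi> x) / (y - x)"
  proof -
    have "0 \<le> (\<Psi> y - \<Psi> x) / (y - x)" if "y \<in> {a..b}" for y
      using mono_onD[OF mono_Psi, of x y] mono_onD[OF mono_Psi, of y x] that x
      by (cases "x \<le> y") (auto simp: divide_nonneg_nonneg divide_nonpos_nonpos)
    then show ?thesis by (auto simp: eventually_at_filter)
  qed
  moreover have "at x within {a..b} \<noteq> bot"
    using x ab by (simp add: trivial_limit_within islimpt_Icc)
  ultimately have "0 \<le> \<Psi>' x"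
    by (rule tendsto_lowerbound)
  with Psi'_nonzero[OF x] show ?thesis by simp
qed

sublocale increasing_scale a b "\<lambda>x. ln (\<Psi> x)" "\<lambda>x. \<Psi>' x / \<Psi> x"
proof
  show "((\<lambda>x. ln (\<Psi> x)) has_real_derivative \<Psi>' x / \<Psi> x) (at x within {a..b})" if "x \<in> {a..b}" for x
    using that by (auto intro!: derivative_eq_intros deriv_Psi Psi_pos)
  show "continuous_on {a..b} (\<lambda>x. \<Psi>' x / \<Psi> x)"
    using Psi_pos by (intro continuous_on_divide cont_Psi cont_Psi') force
qed (use ab Psi'_pos Psi_pos in auto)

abbreviation tempered :: "complex \<Rightarrow> (real \<rightharpoonup> complex) \<Rightarrow> (real \<rightharpoonup> complex)" where
  "tempered s \<equiv> partial_mult (\<lambda>x. complex_of_real (\<Psi> x) powr s)"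

text \<open>
  Outside \<open>{a..b}\<close> the function \<open>\<Psi>\<close> may vanish and the two factors need not cancel.
\<close>

lemma tempered_inverse:
  assumes "dom g \<subseteq> {a..b}"
  shows "tempered s (tempered (- s) g) = g"
proof
  fix x
  show "tempered s (tempered (- s) g) x = g x"
  proof (cases "g x")
    case (Some y)
    then have "x \<in> {a..b}" using assms by blast
    from Psi_pos[OF this] have "complex_of_real (\<Psi> x) powr s \<noteq> 0" by simp
    then show ?thesis using Some by (simp add: partial_mult_def powr_minus)
  qed (simp add: partial_mult_def)
qed

text \<open>
  Off \<open>dom g\<close> the two integrands may differ, because there they are built from an unspecified value;
  this happens only on a negligible set when either side is defined.
\<close>

lemma hadamard_integral_eq_tempered:
  "hadamard_integral a b \<Psi> \<Psi>' \<mu> s g = tempered (- s) (RL_integral \<mu> (tempered s g))"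
proof
  fix x
  let ?K = "\<lambda>t. of_real (kernel \<mu> x t) * the (tempered s g t)"
  let ?H = "hadamard_integrand \<Psi> \<Psi>' \<mu> s g x"
  define c where "c = complex_of_real (\<Psi> x) powr (- s)"
  show "hadamard_integral a b \<Psi> \<Psi>' \<mu> s g x = tempered (- s) (RL_integral \<mu> (tempered s g)) x"
  proof (cases "x \<in> {a..b} \<and> negligible ({a..x} - dom g)")
    case True
    have c: "c \<noteq> 0" using Psi_pos[of x] True by (simp add: c_def)
    have H: "?H t = c * ?K t" if t: "t \<in> {a..x} - ({a..x} - dom g)" for t
    proof -
      from t obtain y where y: "g t = Some y" by auto
      have pos: "\<Psi> t > 0" "\<Psi> x > 0" using t True Psi_pos by auto
      show ?thesis
        unfolding hadamard_integrand_def kernel_def c_def of_real_divide_powr[OF pos]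
        using pos y by (simp add: partial_mult_def ln_div mult_ac)
    qed
    have "?H absolutely_integrable_on {a..x} \<longleftrightarrow> (\<lambda>t. c * ?K t) absolutely_integrable_on {a..x}"
      by (rule absolutely_integrable_spike_eq[of "{a..x} - dom g"]) (use True H in \<open>simp_all only: simp_thms\<close>)
    also have "\<dots> \<longleftrightarrow> ?K absolutely_integrable_on {a..x}"
      by (rule set_integrable_mult_right_iff[OF c])
    finally have iff: "?H absolutely_integrable_on {a..x} \<longleftrightarrow> ?K absolutely_integrable_on {a..x}" .
    have "(LINT t:{a..x}|lebesgue. ?H t) = c * integral {a..x} ?K" if "?H absolutely_integrable_on {a..x}"
    proof -
      have "(LINT t:{a..x}|lebesgue. ?H t) = integral {a..x} ?H"
        using that by (rule set_lebesgue_integral_eq_integral(2))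
      also have "\<dots> = integral {a..x} (\<lambda>t. c * ?K t)"
        using True H by (intro integral_spike[of "{a..x} - dom g"]) auto
      also have "\<dots> = c * integral {a..x} ?K" by simp
      finally show ?thesis .
    qed
    moreover have "tempered (- s) (RL_integral \<mu> (tempered s g)) x =
        map_option ((*) c) (RL_integral \<mu> (tempered s g) x)"
      by (simp only: partial_mult_def c_def)
    ultimately show ?thesis
      using True iff unfolding hadamard_integral_def RL_integral_def dom_partial_mult
      by (simp only: if_True if_False simp_thms option.map split: if_split) simp
  next
    case False
    then have "hadamard_integral a b \<Psi> \<Psi>' \<mu> s g x = None" "RL_integral \<mu> (tempered s g) x = None"
      unfolding hadamard_integral_def RL_integral_def dom_partial_mult by argo+
    then show ?thesis by (simp only: partial_mult_def option.map)
  qed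
qed

lemma hadamard_deriv_eq_tempered:
  "hadamard_deriv a b \<Psi> \<Psi>' n s g = tempered (- s) ((scale_deriv ^^ n) (tempered s g))"
proof -
  have "(\<lambda>g. partial_mult (\<lambda>x. of_real (\<Psi> x / \<Psi>' x)) (partial_deriv a b g)) = scale_deriv"
    by (simp add: scale_deriv_def fun_eq_iff)
  then show ?thesis by (simp add: hadamard_deriv_def)
qed

lemma dom_RL_integral: "dom (RL_integral \<mu> g) \<subseteq> {a..b}"
proof
  fix x
  assume "x \<in> dom (RL_integral \<mu> g)"
  then show "x \<in> {a..b}" by (auto simp only: RL_integral_def domIff split: if_splits)
qed

lemma dom_RL_op: "dom (RL_op \<mu> g) \<subseteq> {a..b}"
proof (cases "\<mu> < 0")
  case True
  then show ?thesis by (simp add: RL_op_def dom_RL_integral)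
next
  case False
  have "dom (scale_deriv g') \<subseteq> {a..b}" for g'
    by (auto simp: dom_scale_deriv partial_deriv_def split: if_splits)
  with False show ?thesis by (simp add: RL_op_def Let_def)
qed

lemma hadamard_RL_eq_tempered:
  "hadamard_RL a b \<Psi> \<Psi>' \<mu> s g = tempered (- s) (RL_op \<mu> (tempered s g))"
  unfolding hadamard_RL_def RL_op_def Let_def hadamard_deriv_eq_tempered hadamard_integral_eq_tempered
  by (simp add: tempered_inverse dom_RL_integral)

lemma tempered_absolutely_integrable:
  assumes "f absolutely_integrable_on {a..b}"
  shows "(\<lambda>x. complex_of_real (\<Psi> x) powr s * f x) absolutely_integrable_on {a..b}"
proof -
  have "continuous_on {a..b} (\<lambda>x. exp (s * of_real (ln (\<Psi> x))))"
    using Psi_pos by (intro continuous_intros cont_Psi) force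
  then have cont: "continuous_on {a..b} (\<lambda>x. complex_of_real (\<Psi> x) powr s)"
    using Psi_pos by (subst continuous_on_cong[OF refl of_real_powr_eq_exp]) auto
  show ?thesis
    using absolutely_integrable_bounded_measurable_product[OF bilinear_times
        continuous_imp_measurable_on_sets_lebesgue[OF cont] _
        compact_imp_bounded[OF compact_continuous_image[OF cont]] assms] by auto
qed

end

theorem proposition3p12:
  fixes a b :: real and s :: complex and \<Psi> \<Psi>' :: "real \<Rightarrow> real" and f :: "real \<Rightarrow> complex"
  assumes "a < b"
    and "\<And>x. x \<in> {a..b} \<Longrightarrow> (\<Psi> has_real_derivative \<Psi>' x) (at x within {a..b})"
    and "continuous_on {a..b} \<Psi>'"
    and "\<And>x. x \<in> {a..b} \<Longrightarrow> \<Psi> x > 0"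
    and "mono_on {a..b} \<Psi>"
    and "\<And>x. x \<in> {a..b} \<Longrightarrow> \<Psi>' x \<noteq> 0"
    and "f absolutely_integrable_on {a..b}"
  shows
    "(\<forall>\<mu> \<nu> :: real. \<forall>x\<in>{a..b}. \<mu> > 0 \<longrightarrow> \<nu> > 0 \<longrightarrow>
        x \<in> dom (hadamard_integral a b \<Psi> \<Psi>' (\<nu> + \<mu>) s (Some \<circ> f)) \<longrightarrow>
        hadamard_integral a b \<Psi> \<Psi>' \<nu> s (hadamard_integral a b \<Psi> \<Psi>' \<mu> s (Some \<circ> f)) x
          = hadamard_integral a b \<Psi> \<Psi>' (\<nu> + \<mu>) s (Some \<circ> f) x)
     \<and> (\<forall>\<mu> \<nu> :: real. \<forall>x\<in>{a<..b}. \<nu> > 0 \<longrightarrow>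
        x \<in> dom (hadamard_RL a b \<Psi> \<Psi>' \<mu> s (hadamard_integral a b \<Psi> \<Psi>' \<nu> s (Some \<circ> f))) \<longrightarrow>
        x \<in> dom (hadamard_RL a b \<Psi> \<Psi>' (\<mu> - \<nu>) s (Some \<circ> f)) \<longrightarrow>
        hadamard_RL a b \<Psi> \<Psi>' \<mu> s (hadamard_integral a b \<Psi> \<Psi>' \<nu> s (Some \<circ> f)) x
          = hadamard_RL a b \<Psi> \<Psi>' (\<mu> - \<nu>) s (Some \<circ> f) x)
     \<and> (\<forall>(n :: nat) (\<mu> :: real). \<forall>x\<in>{a<..b}. n > 0 \<longrightarrow>
        x \<in> dom (hadamard_deriv a b \<Psi> \<Psi>' n s (hadamard_RL a b \<Psi> \<Psi>' \<mu> s (Some \<circ> f))) \<longrightarrow>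
        x \<in> dom (hadamard_RL a b \<Psi> \<Psi>' (real n + \<mu>) s (Some \<circ> f)) \<longrightarrow>
        hadamard_deriv a b \<Psi> \<Psi>' n s (hadamard_RL a b \<Psi> \<Psi>' \<mu> s (Some \<circ> f)) x
          = hadamard_RL a b \<Psi> \<Psi>' (real n + \<mu>) s (Some \<circ> f) x)"
proof -
  interpret hadamard_setting a b \<Psi> \<Psi>'
    by unfold_locales (use assms in auto)
  define h where "h = (\<lambda>x. complex_of_real (\<Psi> x) powr s * f x)"
  have h: "h absolutely_integrable_on {a..b}"
    unfolding h_def using assms(7) by (rule tempered_absolutely_integrable)
  have tempered_f: "tempered s (Some \<circ> f) = Some \<circ> h"
    by (simp add: partial_mult_def h_def fun_eq_iff)
  have tempered_cong: "tempered r g1 x = tempered r g2 x" if "g1 x = g2 x" for r g1 g2 x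
    using that by (simp add: partial_mult_def)
  show ?thesis
    unfolding hadamard_RL_eq_tempered hadamard_deriv_eq_tempered hadamard_integral_eq_tempered
      tempered_inverse[OF dom_RL_integral] tempered_inverse[OF dom_RL_op] tempered_f dom_partial_mult
    by (intro conjI allI ballI impI tempered_cong RL_integral_semigroup RL_op_RL_integral
        scale_deriv_pow_RL_op h)
qed

end
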